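(* Let $y\ge1$ be an integer, let $k\ge0$ be the integer with $2^k\le y<2^{k+1}$, and for $x,z\in\mathbb{N}$ let $x'$ and $z'$ be the reductions (residues in $\{0,\dots,2^{k+1}-1\}$) of $x$ and $z$, respectively, modulo $2^{k+1}$. 1. If there exists $(x,z)\in\mathrm{Ulam}[y]$ with $x+z<2^{k+1}-1$, then $y$ is a Zumkeller number. 2. If $y$ is not a Zumkeller number, then $(x,z)\in\mathrm{Ulam}[y]$ only if $2^{k+1}-1\le x'+z'\le2^{k+2}-y-2$. If $y$ is a Zumkeller number, then for every $(x,z)\in\mathrm{Ulam}[y]$ this inequality holds unless $x+z\in\{y,y+1,y+2\}$. 3. If $y\notin\{2^{k+1}-1,2^{k+1}-2\}$, then $(x,z)\in\mathrm{Ulam}[y]$ for all $(x,z)\in\mathbb{N}^2$ with $x+z\equiv-1\pmod{2^{k+1}}$ and for all $(x,z)\in\mathbb{N}^2$ with $x'+z'=2\left\lfloor\frac{2^{k+2}-y-3}{2}\right\rfloor+1$. If $y=2^{k+1}-1$ or $y=2^{k+1}-2$, then the same result holds except when $x+z=2^{k+1}-1$.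
   Context: $\mathbb{N}=\{0,1,2,\dots\}$. Ulam words are binary words defined recursively: $\mathcal{U}(1)=\{0,1\}$, and for $n>1$, $\mathcal{U}(n)$ is the set of all words of length $n$ over $\{0,1\}$ that are expressible uniquely as a concatenation $uv$ of two distinct words $u\in\mathcal{U}(i)$, $v\in\mathcal{U}(j)$ with $i,j<n$ (i.e. there is exactly one ordered pair $(u,v)$ of such words, $u\ne v$). A word is Ulam if it belongs to $\bigcup_{n\ge1}\mathcal{U}(n)$. $0^m$ denotes a block of $m$ zeros. $\mathrm{Ulam}[y]\subset\mathbb{N}^2$ is the set of $(x,z)$ such that the word $0^x10^y10^z$ is Ulam. A positive integer is a Zumkeller number if it has at most one $0$ in its binary representation. *)

theory Defs
  imports "HOL-Number_Theory.Cong"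
begin

text \<open>Binary words are boolean lists, with False for the letter 0 and True for the letter 1.\<close>

type_synonym word = "bool list"

fun ulam_level :: "nat \<Rightarrow> word set" where
  "ulam_level n =
    (if n = 0 then {}
     else if n = 1 then {[False], [True]}
     else {w. length w = n \<and>
              (\<exists>!p. case p of (u, v) \<Rightarrow>
                 w = u @ v \<and> u \<noteq> v \<and>
                 (\<exists>i\<in>{..<n}. u \<in> ulam_level i) \<and> (\<exists>j\<in>{..<n}. v \<in> ulam_level j))})"

declare ulam_level.simps [simp del]

definition ulam_word :: "word \<Rightarrow> bool" where
  "ulam_word w \<longleftrightarrow> w \<in> (\<Union>n\<in>{1..}. ulam_level n)"

definition Ulam :: "nat \<Rightarrow> (nat \<times> nat) set" where
  "Ulam y = {(x, z). ulam_word
     (replicate x False @ [True] @ replicate y False @ [True] @ replicate z False)}"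

text \<open>The digit positions in the binary representation of \<open>n > 0\<close> (without leading zeros)
  are exactly the \<open>i\<close> with \<open>2 ^ i \<le> n\<close>; this also makes the set below finite.\<close>

definition zumkeller :: "nat \<Rightarrow> bool" where
  "zumkeller n \<longleftrightarrow> n > 0 \<and> card {i. 2 ^ i \<le> n \<and> \<not> bit n i} \<le> 1"

end

theory Submission
  imports Defs
begin

text \<open>A word with a single 1, \<open>0\<^sup>a10\<^sup>b\<close>, is Ulam iff \<open>a\<close> and \<open>b\<close> have no common binary digit 1.
  Hence a word \<open>0\<^sup>x10\<^sup>y10\<^sup>z\<close> is Ulam iff 1 is the sum of three numbers: the indicators for
  \<open>(x - 1, z)\<close> and \<open>(x, z - 1)\<close>, and the number of \<open>i \<le> y\<close> such that \<open>i\<close> is disjoint from \<open>x\<close> and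
  \<open>y - i\<close> from \<open>z\<close>, lowered by one if \<open>i = z\<close>, \<open>y - i = x\<close> is such a splitting, because then the two
  halves of the word coincide. With \<open>M = 2\<^bsup>k+1\<^esup>\<close>, the number of splittings depends only on \<open>x\<close> and \<open>z\<close>
  modulo \<open>M\<close> and obeys recursions in the last binary digits of \<open>x\<close>, \<open>z\<close> and \<open>y\<close>. These show that the
  recursion is solved by an explicit pattern: nothing for \<open>x' + z' < M - 1\<close>, except for correction terms
  on the line \<open>x + z = y\<close>, and otherwise the points with \<open>x' + z'\<close> odd and exactly one splitting, except
  in the block \<open>x, z < M\<close> if \<open>y \<ge> M - 2\<close>. On the line \<open>x + z = y\<close> there are more splittings than
  there are zeros in the binary representation of \<open>y\<close>, which brings in the Zumkeller numbers.\<close>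

section \<open>Disjoint binary expansions\<close>

definition disjoint_bits :: "nat \<Rightarrow> nat \<Rightarrow> bool" where
  "disjoint_bits x y \<longleftrightarrow> (\<forall>i. \<not> (bit x i \<and> bit y i))"

lemma disjoint_bits_rec:
  "disjoint_bits x y \<longleftrightarrow> \<not> (odd x \<and> odd y) \<and> disjoint_bits (x div 2) (y div 2)"
proof -
  have "(\<forall>i. P i) \<longleftrightarrow> P 0 \<and> (\<forall>i. P (Suc i))" for P :: "nat \<Rightarrow> bool"
    by (metis not0_implies_Suc)
  from this [of "\<lambda>i. \<not> (bit x i \<and> bit y i)"] show ?thesis
    by (simp add: disjoint_bits_def bit_0 bit_Suc)
qed

lemma disjoint_bits_0 [simp]: "disjoint_bits 0 y" "disjoint_bits x 0"
  by (simp_all add: disjoint_bits_def)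

lemma disjoint_bits_double [simp]:
  "disjoint_bits (2 * a) (2 * b) \<longleftrightarrow> disjoint_bits a b"
  "disjoint_bits (Suc (2 * a)) (2 * b) \<longleftrightarrow> disjoint_bits a b"
  "disjoint_bits (2 * a) (Suc (2 * b)) \<longleftrightarrow> disjoint_bits a b"
  "\<not> disjoint_bits (Suc (2 * a)) (Suc (2 * b))"
  by (subst disjoint_bits_rec; simp)+

lemma disjoint_bits_commute: "disjoint_bits x y \<longleftrightarrow> disjoint_bits y x"
  by (auto simp: disjoint_bits_def)

lemma disjoint_bits_mod:
  assumes "i < 2 ^ m"
  shows "disjoint_bits (x mod 2 ^ m) i \<longleftrightarrow> disjoint_bits x i"
proof -
  have "\<not> bit i n" if "n \<ge> m" for n
    using assms that
    by (metis bit_take_bit_iff not_less take_bit_nat_eq_self)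
  then show ?thesis
    by (auto simp: disjoint_bits_def bit_take_bit_iff simp flip: take_bit_eq_mod)
qed

lemma double_cases:
  fixes n :: nat
  obtains a where "n = 2 * a" | a where "n = Suc (2 * a)"
  by (metis evenE oddE Suc_eq_plus1)

lemma double_neq_Suc_double: "2 * a \<noteq> Suc (2 * b)" "Suc (2 * b) \<noteq> 2 * a" for a b :: nat
  by presburger+

text \<open>By Kummer's theorem \<open>disjoint_bits a b\<close> says that the binomial coefficient of \<open>a + b\<close> over
  \<open>a\<close> is odd; this is Pascal's rule modulo 2.\<close>

lemma disjoint_bits_pascal:
  "a > 0 \<Longrightarrow> b > 0 \<Longrightarrow>
    disjoint_bits a b \<longleftrightarrow> disjoint_bits (a - 1) b \<noteq> disjoint_bits a (b - 1)"
proof (induction a arbitrary: b rule: less_induct)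
  case (less a)
  show ?case
  proof (cases a rule: double_cases; cases b rule: double_cases)
    fix c d assume ab: "a = 2 * c" "b = 2 * d"
    then have pos: "c > 0" "d > 0" using less.prems by auto
    then have eq: "a - 1 = Suc (2 * (c - 1))" "b - 1 = Suc (2 * (d - 1))" using ab by auto
    show ?thesis
      unfolding eq using less.IH [of c d] pos ab by simp
  next
    fix c d assume ab: "a = 2 * c" "b = Suc (2 * d)"
    then have eq: "a - 1 = Suc (2 * (c - 1))" using less.prems by auto
    show ?thesis
      unfolding eq using ab by simp
  next
    fix c d assume ab: "a = Suc (2 * c)" "b = 2 * d"
    then have eq: "b - 1 = Suc (2 * (d - 1))" using less.prems by auto
    show ?thesis
      unfolding eq using ab by simp
  next
    fix c d assume ab: "a = Suc (2 * c)" "b = Suc (2 * d)"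
    then show ?thesis by simp
  qed
qed

section \<open>Splittings of the inner block of zeros\<close>

text \<open>As a power series in t, the sum of \<open>nsplit x z y\<close> t^y over all y is the
  product of the factors 1 + t^(2^j) over the zero digits j of x and over those of z.\<close>

definition nsplit :: "nat \<Rightarrow> nat \<Rightarrow> nat \<Rightarrow> nat" where
  "nsplit x z y = card {i. i \<le> y \<and> disjoint_bits x i \<and> disjoint_bits z (y - i)}"

lemma nsplit_commute: "nsplit x z y = nsplit z x y"
  unfolding nsplit_def
  by (rule bij_betw_same_card [of "\<lambda>i. y - i"], rule bij_betw_byWitness [where f' = "\<lambda>i. y - i"]) auto

lemma nsplit_mod:
  assumes "y < 2 ^ m"
  shows "nsplit (x mod 2 ^ m) (z mod 2 ^ m) y = nsplit x z y"
  unfolding nsplit_def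
  by (rule arg_cong [where f = card], rule Collect_cong)
    (use assms in \<open>auto simp: disjoint_bits_mod\<close>)

lemma nsplit_parity:
  "nsplit x z y =
    card {i. 2 * i \<le> y \<and> disjoint_bits x (2 * i) \<and> disjoint_bits z (y - 2 * i)} +
    card {i. Suc (2 * i) \<le> y \<and> disjoint_bits x (Suc (2 * i)) \<and> disjoint_bits z (y - Suc (2 * i))}"
    (is "_ = card ?A + card ?B")
proof -
  let ?S = "{i. i \<le> y \<and> disjoint_bits x i \<and> disjoint_bits z (y - i)}"
  have fin: "finite ?A" "finite ?B" by (auto intro: finite_subset [of _ "{..y}"])
  have mem: "2 * a \<in> (\<lambda>i. 2 * i) ` A \<union> (\<lambda>i. Suc (2 * i)) ` B \<longleftrightarrow> a \<in> A"
    "Suc (2 * a) \<in> (\<lambda>i. 2 * i) ` A \<union> (\<lambda>i. Suc (2 * i)) ` B \<longleftrightarrow> a \<in> B"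
    for a :: nat and A B
    using double_neq_Suc_double by force+
  have "?S = (\<lambda>i. 2 * i) ` ?A \<union> (\<lambda>i. Suc (2 * i)) ` ?B"
  proof (rule set_eqI)
    fix i show "i \<in> ?S \<longleftrightarrow> i \<in> (\<lambda>i. 2 * i) ` ?A \<union> (\<lambda>i. Suc (2 * i)) ` ?B"
      by (cases i rule: double_cases) (simp_all only: mem mem_Collect_eq)
  qed
  moreover have "(\<lambda>i. 2 * i) ` ?A \<inter> (\<lambda>i. Suc (2 * i)) ` ?B = {}"
    using double_neq_Suc_double by blast
  then have "card ((\<lambda>i. 2 * i) ` ?A \<union> (\<lambda>i. Suc (2 * i)) ` ?B) = card ?A + card ?B"
    using fin by (simp only: card_Un_disjoint finite_imageI card_image inj_on_def) (simp add: card_image inj_on_def)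
  ultimately show ?thesis by (simp add: nsplit_def)
qed

text \<open>An odd x or z forces the summand next to it to be even; halving the summands then
  removes the last digits. For even x and z both parities occur, and two odd summands of 2c halve to
  summands of c - 1.\<close>

lemma nsplit_double:
  "nsplit (2 * a) (2 * b) (2 * c) = nsplit a b c + (if c = 0 then 0 else nsplit a b (c - 1))"
  "nsplit (2 * a) (2 * b) (Suc (2 * c)) = 2 * nsplit a b c"
  "nsplit (Suc (2 * a)) (2 * b) (2 * c) = nsplit a b c"
  "nsplit (Suc (2 * a)) (2 * b) (Suc (2 * c)) = nsplit a b c"
  "nsplit (2 * a) (Suc (2 * b)) (2 * c) = nsplit a b c"
  "nsplit (2 * a) (Suc (2 * b)) (Suc (2 * c)) = nsplit a b c"
  "nsplit (Suc (2 * a)) (Suc (2 * b)) (2 * c) = nsplit a b c"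
  "nsplit (Suc (2 * a)) (Suc (2 * b)) (Suc (2 * c)) = 0"
proof -
  have le: "2 * i \<le> 2 * c \<longleftrightarrow> i \<le> c" "2 * i \<le> Suc (2 * c) \<longleftrightarrow> i \<le> c"
    "Suc (2 * i) \<le> 2 * c \<longleftrightarrow> i < c" "Suc (2 * i) \<le> Suc (2 * c) \<longleftrightarrow> i \<le> c" for i
    by presburger+
  have diff: "2 * c - 2 * i = 2 * (c - i)" "i \<le> c \<Longrightarrow> Suc (2 * c) - 2 * i = Suc (2 * (c - i))"
    "i < c \<Longrightarrow> 2 * c - Suc (2 * i) = Suc (2 * (c - 1 - i))" "Suc (2 * c) - Suc (2 * i) = 2 * (c - i)" for i
    by linarith+
  show
    "nsplit (2 * a) (2 * b) (2 * c) = nsplit a b c + (if c = 0 then 0 else nsplit a b (c - 1))"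
    "nsplit (2 * a) (2 * b) (Suc (2 * c)) = 2 * nsplit a b c"
    "nsplit (Suc (2 * a)) (2 * b) (2 * c) = nsplit a b c"
    "nsplit (Suc (2 * a)) (2 * b) (Suc (2 * c)) = nsplit a b c"
    "nsplit (2 * a) (Suc (2 * b)) (2 * c) = nsplit a b c"
    "nsplit (2 * a) (Suc (2 * b)) (Suc (2 * c)) = nsplit a b c"
    "nsplit (Suc (2 * a)) (Suc (2 * b)) (2 * c) = nsplit a b c"
    "nsplit (Suc (2 * a)) (Suc (2 * b)) (Suc (2 * c)) = 0"
    by (simp only: nsplit_parity [of "2 * a"] nsplit_parity [of "Suc (2 * a)"]
        le diff disjoint_bits_double cong: conj_cong; cases c; simp add: nsplit_def less_Suc_eq_le)+
qed

section \<open>Positivity and comparison of neighbouring points\<close>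

lemma nsplit_at_0 [simp]: "nsplit x z 0 = 1"
proof -
  have "{i. i \<le> (0::nat) \<and> disjoint_bits x i \<and> disjoint_bits z (0 - i)} = {0}" by auto
  then show ?thesis by (simp add: nsplit_def)
qed

lemma nsplit_posI:
  "disjoint_bits x i \<Longrightarrow> disjoint_bits z j \<Longrightarrow> i + j = y \<Longrightarrow> nsplit x z y > 0"
  unfolding nsplit_def by (subst card_gt_0_iff) (auto intro!: exI [of _ i])

lemma nsplit_self_pos: "disjoint_bits x z \<Longrightarrow> x + z = y \<Longrightarrow> nsplit x z y > 0"
  by (rule nsplit_posI [of _ z _ x]) (auto simp: disjoint_bits_commute)

lemma nsplit_eq_0_imp_pos:
  assumes "nsplit x z y = 0"
  shows "x > 0 \<and> z > 0"
  using assms nsplit_posI [of x y z 0] nsplit_posI [of x 0 z y] by (cases x; cases z) auto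

text \<open>Modulo 2 the power series for x is 1 + t times that for x + 1, so
  \<open>nsplit x z (Suc c)\<close> has the parity of
  \<open>nsplit (Suc x) z (Suc c) + nsplit (Suc x) z c\<close>. If the first of these terms
  vanishes, the equivalence of being odd sharpens to one of being 1.\<close>

lemma nsplit_eq_1_shift:
  "nsplit (Suc x) z (Suc c) = 0 \<Longrightarrow>
    nsplit x z (Suc c) = 1 \<longleftrightarrow> nsplit (Suc x) z c = 1"
proof (induction c arbitrary: x z rule: less_induct)
  case (less c)
  have double_Suc: "Suc (Suc (2 * n)) = 2 * Suc n" for n by simp
  obtain a where a: "x = 2 * a \<or> x = Suc (2 * a)" by (metis double_cases)
  obtain b where b: "z = 2 * b \<or> z = Suc (2 * b)" by (metis double_cases)
  \<comment> \<open>In the two nonzero cases \<open>Suc c\<close> halves to \<open>Suc d\<close>, so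
    one instance of the induction hypothesis serves both.\<close>
  obtain d where d: "c = 2 * 0 \<or> c = 2 * Suc d \<or> c = Suc (2 * d)"
    by (metis double_cases not0_implies_Suc)
  have IH: "nsplit (Suc a) b (Suc d) = 0 \<Longrightarrow>
    nsplit a b (Suc d) = 1 \<longleftrightarrow> nsplit (Suc a) b d = 1" if "c \<noteq> 0"
    by (rule less.IH) (use d that in auto)
  from a b d less.prems show ?case
    by (elim disjE; simp only: double_Suc nsplit_double; use IH in auto)
qed

text \<open>The image of the previous lemma under replacing every summand by its complement within the
  positions that are free for it.\<close>

lemma nsplit_eq_1_shift':
  "nsplit (Suc x) z c = 0 \<Longrightarrow>
    nsplit x z (Suc c) = 1 \<longleftrightarrow> nsplit (Suc x) z (Suc c) = 1"
proof (induction c arbitrary: x z rule: less_induct)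
  case (less c)
  have double_Suc: "Suc (Suc (2 * n)) = 2 * Suc n" for n by simp
  obtain a where a: "x = 2 * a \<or> x = Suc (2 * a)" by (metis double_cases)
  obtain b where b: "z = 2 * b \<or> z = Suc (2 * b)" by (metis double_cases)
  obtain d where d: "c = 2 * 0 \<or> c = 2 * Suc d \<or> c = Suc (2 * d)"
    by (metis double_cases not0_implies_Suc)
  have IH: "nsplit (Suc a) b d = 0 \<Longrightarrow>
    nsplit a b (Suc d) = 1 \<longleftrightarrow> nsplit (Suc a) b (Suc d) = 1" if "c \<noteq> 0"
    by (rule less.IH) (use d that in auto)
  from a b d less.prems show ?case
    by (elim disjE; simp only: double_Suc nsplit_double; use IH in auto)
qed

text \<open>This keeps points with even x + z out of the pattern. Without a splitting, both
  indicators reduce to the same condition \<open>nsplit x z (y - 1) = 1\<close>; with exactly one,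
  the left neighbour has exactly one too, and the total is at least 2.\<close>

lemma nsplit_even_sum:
  assumes "x > 0" "z > 0" "y > 0" "even (x + z)"
  shows "nsplit x z y + of_bool (nsplit (x - 1) z y = 1) + of_bool (nsplit x (z - 1) y = 1) \<noteq> (1::nat)"
proof -
  obtain x' z' y' where eq: "x = Suc x'" "z = Suc z'" "y = Suc y'"
    using assms by (meson gr0_implies_Suc)
  show ?thesis
  proof (cases "nsplit x z y = 0")
    case True
    have "nsplit (x - 1) z y = 1 \<longleftrightarrow> nsplit x z y' = 1"
      using nsplit_eq_1_shift [of x' z y'] True unfolding eq by simp
    moreover have "nsplit x (z - 1) y = 1 \<longleftrightarrow> nsplit x z y' = 1"
      using nsplit_eq_1_shift [of z' x y'] True unfolding eq by (simp add: nsplit_commute)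
    ultimately show ?thesis using True by (auto simp: of_bool_def)
  next
    case False
    have "nsplit (x - 1) z y = 1" if one: "nsplit x z y = 1"
    proof (cases x' rule: double_cases)
      case (1 a)
      then have a: "x = Suc (2 * a)" "x - 1 = 2 * a" using eq by simp_all
      then obtain b where b: "z = Suc (2 * b)" using assms by (cases z rule: double_cases) auto
      obtain c where c: "y = 2 * c"
      proof (cases y rule: double_cases)
        case (1 c)
        then show ?thesis by (rule that)
      next
        case (2 c)
        then show ?thesis using one unfolding a b 2 nsplit_double by simp
      qed
      show ?thesis using one unfolding a(2) unfolding a(1) b c nsplit_double .
    next
      case (2 a)
      then have a: "x = 2 * Suc a" "x - 1 = Suc (2 * a)" using eq by simp_all
      then obtain b where b: "z = 2 * b" using assms by (auto elim: evenE)
      obtain c where c: "y = 2 * Suc c"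
      proof (cases y rule: double_cases)
        case (1 c)
        then have "y = 2 * Suc (c - 1)" using assms by simp
        then show ?thesis by (rule that)
      next
        case (2 c)
        then show ?thesis using one a b by (simp add: nsplit_double del: mult_Suc_right)
      qed
      have "nsplit (Suc a) b (Suc c) + nsplit (Suc a) b c = 1"
        using one unfolding a b c nsplit_double by simp
      \<comment> \<open>One of the two terms is 0 and the other 1; each shift lemma settles one of
        these cases.\<close>
      then have "nsplit a b (Suc c) = 1"
        using nsplit_eq_1_shift [of a b c] nsplit_eq_1_shift' [of a b c] by (auto simp: add_is_1)
      then show ?thesis unfolding a(2) unfolding b c nsplit_double .
    qed
    then show ?thesis using False by auto
  qed
qed

section \<open>The number of splittings on, above and below the line x + z = 2^m - 1\<close>

lemma nsplit_complement: "x + z + 1 = 2 ^ m \<Longrightarrow> y < 2 ^ m \<Longrightarrow> nsplit x z y = 1"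
proof (induction m arbitrary: x z y)
  case 0
  then show ?case by simp
next
  case (Suc m)
  then have eq: "x + z + 1 = 2 * 2 ^ m" "y < 2 * 2 ^ m" by simp_all
  \<comment> \<open>Below position m the digits of x and z are complementary, so each digit of y
    fits into exactly one summand. For the last digit this means that exactly one of x and z is
    odd.\<close>
  then have "odd (x + z)" by presburger
  with eq show ?case
    by (cases x rule: double_cases; cases z rule: double_cases; cases y rule: double_cases;
      simp del: One_nat_def add: nsplit_double) (intro Suc.IH; linarith)+
qed

text \<open>Disjoint numbers below 2^m add up to at most 2^m - 1. For a splitting, adding these
  bounds for x, i and for z, y - i gives x + z + y <= 2 * 2^m - 2.\<close>

lemma nsplit_excess:
  "x < 2 ^ m \<Longrightarrow> z < 2 ^ m \<Longrightarrow> y < 2 ^ m \<Longrightarrow> x + z + y + 2 > 2 * 2 ^ m \<Longrightarrow> nsplit x z y = 0"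
proof (induction m arbitrary: x z y)
  case 0
  then show ?case by simp
next
  case (Suc m)
  have IH: "nsplit a b c = 0"
    if "a < 2 ^ m" "b < 2 ^ m" "c < 2 ^ m" "2 * 2 ^ m < a + b + c + 2" for a b c
    using Suc.IH that .
  have "x < 2 * 2 ^ m" "z < 2 * 2 ^ m" "y < 2 * 2 ^ m" "x + z + y + 2 > 2 * (2 * 2 ^ m)"
    using Suc.prems by simp_all
  then show ?case
    by (cases x rule: double_cases; cases z rule: double_cases; cases y rule: double_cases;
      simp del: One_nat_def add: nsplit_double) (intro conjI impI IH; linarith)+
qed

text \<open>This is the equality case of the bound behind \<open>nsplit_excess\<close>: it forces i
  = 2^m - 1 - x and y - i = 2^m - 1 - z, and these form a splitting.\<close>

lemma nsplit_tight:
  "x < 2 ^ m \<Longrightarrow> z < 2 ^ m \<Longrightarrow> y < 2 ^ m \<Longrightarrow> x + z + y + 2 = 2 * 2 ^ m \<Longrightarrow> nsplit x z y = 1"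
proof (induction m arbitrary: x z y)
  case 0
  then show ?case by simp
next
  case (Suc m)
  have 0: "nsplit a b c = 0"
    if "a < 2 ^ m" "b < 2 ^ m" "c < 2 ^ m" "2 * 2 ^ m < a + b + c + 2" for a b c
    using nsplit_excess that .
  have lt: "x < 2 * 2 ^ m" "z < 2 * 2 ^ m" "y < 2 * 2 ^ m" "x + z + y + 2 = 2 * (2 * 2 ^ m)"
    using Suc.prems by simp_all
  then have "even (x + z + y)" by presburger
  consider (eee) a b c where "x = 2 * a" "z = 2 * b" "y = 2 * c"
    | (eoo) a b c where "x = 2 * a" "z = Suc (2 * b)" "y = Suc (2 * c)"
    | (oeo) a b c where "x = Suc (2 * a)" "z = 2 * b" "y = Suc (2 * c)"
    | (ooe) a b c where "x = Suc (2 * a)" "z = Suc (2 * b)" "y = 2 * c"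
    using \<open>even (x + z + y)\<close>
    by (cases x rule: double_cases; cases z rule: double_cases; cases y rule: double_cases) auto
  then show ?case
  proof cases
    case eee
    have "a < 2 ^ m" "b < 2 ^ m" using lt eee by simp_all
    then have c: "c > 0" using lt(4) unfolding eee by linarith
    \<comment> \<open>Here a + b + c = 2 * 2^m - 1, which is too large by one for c and tight for c
      - 1.\<close>
    have "nsplit a b c = 0" using lt unfolding eee by (intro 0; linarith)
    moreover have "nsplit a b (c - 1) = 1" using lt c unfolding eee by (intro Suc.IH; linarith)
    ultimately show ?thesis unfolding eee nsplit_double using c by simp
  next
    case eoo
    show ?thesis using lt unfolding eoo nsplit_double by (intro Suc.IH; linarith)
  next
    case oeo
    show ?thesis using lt unfolding oeo nsplit_double by (intro Suc.IH; linarith)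
  next
    case ooe
    show ?thesis using lt unfolding ooe nsplit_double by (intro Suc.IH; linarith)
  qed
qed

lemma disjoint_bits_power: "x < 2 ^ k \<Longrightarrow> disjoint_bits x (2 ^ k)"
  by (auto simp: disjoint_bits_def bit_exp_iff) (metis bit_take_bit_iff less_irrefl take_bit_nat_eq_self)

lemma disjoint_bits_complement: "x + z + 1 = 2 ^ m \<Longrightarrow> disjoint_bits x z"
proof (induction m arbitrary: x z)
  case 0
  then show ?case by simp
next
  case (Suc m)
  then have eq: "x + z + 1 = 2 * 2 ^ m" by simp
  then have "odd (x + z)" by presburger
  with eq show ?case
    by (cases x rule: double_cases; cases z rule: double_cases; simp del: One_nat_def)
      (intro Suc.IH; linarith)+
qed

text \<open>By induction on the digits, the delicate case is that of even x, z and y, where two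
  counts are added. If the halved point is on the line, both are 1; if it is below, neither is 1
  unless c - 1 falls short of the top power of two.\<close>

lemma nsplit_low:
  "x + z + 1 < 2 ^ (k + 1) \<Longrightarrow> 2 ^ k \<le> y \<Longrightarrow> y < 2 ^ (k + 1) \<Longrightarrow> nsplit x z y \<noteq> 1"
proof (induction k arbitrary: x z y)
  case 0
  then have "x = 2 * 0" "z = 2 * 0" "y = Suc (2 * 0)" by simp_all
  then show ?case by (simp only: nsplit_double) simp
next
  case (Suc k)
  define P :: nat where "P = 2 ^ k"
  have IH: "nsplit a b c \<noteq> 1" if "a + b + 1 < 2 * P" "P \<le> c" "c < 2 * P" for a b c
    using Suc.IH [of a b c] that unfolding P_def by simp
  have compl: "nsplit a b c = 1" if "a + b + 1 = 2 * P" "c < 2 * P" for a b c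
    using nsplit_complement [of a b "Suc k" c] that unfolding P_def by simp
  \<comment> \<open>For c = P the count at c - 1 escapes the induction hypothesis, but the count at
    P is then at least 2 as soon as it is positive. One of a, b is below P, so the digit P fits into
    the summand next to it.\<close>
  have pos: "nsplit a b P > 0" if "a + b + 1 < 2 * P" for a b
  proof (cases "a < P")
    case True
    then show ?thesis using disjoint_bits_power [of a k] by (intro nsplit_posI [of _ P _ 0]) (auto simp: P_def)
  next
    case False
    then have "b < P" using that by linarith
    then show ?thesis using disjoint_bits_power [of b k] by (intro nsplit_posI [of _ 0 _ P]) (auto simp: P_def)
  qed
  have bounds: "x + z + 1 < 4 * P" "2 * P \<le> y" "y < 4 * P"
    using Suc.prems by (simp_all add: P_def)
  have "P > 0" by (simp add: P_def)
  consider (eee) a b c where "x = 2 * a" "z = 2 * b" "y = 2 * c"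
    | (eeo) a b c where "x = 2 * a" "z = 2 * b" "y = Suc (2 * c)"
    | (eo) a b c where "x = 2 * a" "z = Suc (2 * b)" "y = 2 * c \<or> y = Suc (2 * c)"
    | (oe) a b c where "x = Suc (2 * a)" "z = 2 * b" "y = 2 * c \<or> y = Suc (2 * c)"
    | (ooe) a b c where "x = Suc (2 * a)" "z = Suc (2 * b)" "y = 2 * c"
    | (ooo) a b c where "x = Suc (2 * a)" "z = Suc (2 * b)" "y = Suc (2 * c)"
    by (cases x rule: double_cases; cases z rule: double_cases; cases y rule: double_cases) metis+
  then show ?case
  proof cases
    case eee
    then have bounds: "a + b + 1 \<le> 2 * P" "P \<le> c" "c < 2 * P" using bounds by linarith+
    show ?thesis
    proof (cases "a + b + 1 = 2 * P")
      case True
      then have "nsplit a b c = 1" "nsplit a b (c - 1) = 1" using compl bounds by simp_all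
      then show ?thesis using bounds \<open>P > 0\<close> unfolding eee nsplit_double by simp
    next
      case False
      then have lt: "a + b + 1 < 2 * P" using bounds by linarith
      have "nsplit a b c \<noteq> 1" using IH lt bounds by simp
      moreover have "nsplit a b (c - 1) \<noteq> 1" if "nsplit a b c = 0"
      proof -
        have "c \<noteq> P" using that pos [OF lt] by auto
        then show ?thesis using bounds lt by (intro IH) linarith+
      qed
      ultimately show ?thesis unfolding eee nsplit_double by (auto simp: add_is_1)
    qed
  next
    case eeo
    show ?thesis unfolding eeo nsplit_double by presburger
  next
    case eo
    then have "nsplit a b c \<noteq> 1" using bounds by (intro IH) linarith+
    then show ?thesis using eo nsplit_double by metis
  next
    case oe
    then have "nsplit a b c \<noteq> 1" using bounds by (intro IH) linarith+
    then show ?thesis using oe nsplit_double by metis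
  next
    case ooe
    then have "nsplit a b c \<noteq> 1" using bounds by (intro IH) linarith+
    then show ?thesis unfolding ooe nsplit_double .
  next
    case ooo
    show ?thesis unfolding ooo nsplit_double by simp
  qed
qed

text \<open>The points (x, z + 1) and (x + 1, z) are the neighbours of (x + 1, z + 1) whose
  coordinates add up to y. If that point has no splitting, the corrections at both neighbours occur
  together and contribute 0 or 2.\<close>

lemma nsplit_neighbours:
  "y = Suc (x + z) \<Longrightarrow> nsplit (Suc x) (Suc z) y = 0 \<Longrightarrow>
    disjoint_bits x (Suc z) \<and> nsplit x (Suc z) y = 2 \<longleftrightarrow>
    disjoint_bits (Suc x) z \<and> nsplit (Suc x) z y = 2"
proof (induction x arbitrary: z y rule: less_induct)
  case (less x)
  have double_Suc: "Suc (Suc (2 * n)) = 2 * Suc n" for n by simp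
  consider (ee) a b where "x = 2 * a" "z = 2 * b" | (eo) a b where "x = 2 * a" "z = Suc (2 * b)"
    | (oe) a b where "x = Suc (2 * a)" "z = 2 * b" | (oo) a b where "x = Suc (2 * a)" "z = Suc (2 * b)"
    by (cases x rule: double_cases; cases z rule: double_cases) metis+
  then show ?case
  proof cases
    case ee
    then have y: "y = Suc (2 * (a + b))" using less.prems by simp
    show ?thesis unfolding ee y nsplit_double disjoint_bits_double by simp
  next
    case eo
    then have y: "y = 2 * Suc (a + b)" using less.prems by simp
    have "nsplit a (Suc b) (Suc (a + b)) = 0"
      using less.prems(2) unfolding eo y double_Suc nsplit_double .
    then have "\<not> disjoint_bits a (Suc b)" using nsplit_self_pos [of a "Suc b"] by auto
    then show ?thesis unfolding eo y double_Suc disjoint_bits_double by simp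
  next
    case oe
    then have y: "y = 2 * Suc (a + b)" using less.prems by simp
    have "nsplit (Suc a) b (Suc (a + b)) = 0"
      using less.prems(2) unfolding oe y double_Suc nsplit_double .
    then have "\<not> disjoint_bits (Suc a) b" using nsplit_self_pos [of "Suc a" b] by auto
    then show ?thesis unfolding oe y double_Suc disjoint_bits_double by simp
  next
    case oo
    then have y: "y = Suc (2 * Suc (a + b))" using less.prems by simp
    have "nsplit (Suc a) (Suc b) (Suc (a + b)) = 0"
      using less.prems(2) unfolding oo y double_Suc nsplit_double by simp
    then show ?thesis
      unfolding oo y double_Suc disjoint_bits_double nsplit_double
      using less.IH [of a "Suc (a + b)" b] oo by simp
  qed
qed

section \<open>Zumkeller numbers\<close>

definition zero_digits :: "nat \<Rightarrow> nat" where
  "zero_digits n = card {i. 2 ^ i \<le> n \<and> \<not> bit n i}"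

lemma finite_zero_digits: "finite {i. 2 ^ i \<le> n \<and> \<not> bit n i}" for n :: nat
  by (rule finite_subset [of _ "{..n}"]) (auto intro: order.trans [OF less_imp_le [OF less_exp]])

lemma zero_digits_double:
  "a > 0 \<Longrightarrow> zero_digits (2 * a) = Suc (zero_digits a)"
  "zero_digits (Suc (2 * a)) = zero_digits a"
proof -
  let ?Z = "\<lambda>n::nat. {i. 2 ^ i \<le> n \<and> \<not> bit n i}"
  have "?Z (2 * a) = insert 0 (Suc ` ?Z a)" if "a > 0"
  proof (rule set_eqI)
    fix i show "i \<in> ?Z (2 * a) \<longleftrightarrow> i \<in> insert 0 (Suc ` ?Z a)"
      using that by (cases i) (auto simp: bit_Suc bit_0)
  qed
  then show "zero_digits (2 * a) = Suc (zero_digits a)" if "a > 0"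
    using that finite_zero_digits [of a] unfolding zero_digits_def by (simp add: card_image)
  have "?Z (Suc (2 * a)) = Suc ` ?Z a"
  proof (rule set_eqI)
    fix i show "i \<in> ?Z (Suc (2 * a)) \<longleftrightarrow> i \<in> Suc ` ?Z a"
    proof (cases i)
      case (Suc j)
      have "2 * 2 ^ j \<le> Suc (2 * a) \<longleftrightarrow> 2 ^ j \<le> a" by presburger
      then show ?thesis using Suc by (auto simp: bit_Suc)
    qed (auto simp: bit_0)
  qed
  then show "zero_digits (Suc (2 * a)) = zero_digits a"
    unfolding zero_digits_def by (simp add: card_image)
qed

lemma zero_digits_0 [simp]: "zero_digits 0 = 0"
  by (simp add: zero_digits_def)

text \<open>The lowest digit 2^r of x + z belongs to x or to z. Lowering that number by one fills
  only positions below r, where the other number has zeros, so disjointness survives.\<close>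

lemma nsplit_pred_pos: "disjoint_bits x z \<Longrightarrow> x + z = Suc c \<Longrightarrow> nsplit x z c > 0"
proof (induction c arbitrary: x z rule: less_induct)
  case (less c)
  consider (ee) a b where "x = 2 * a" "z = 2 * b" | (eo) a b where "x = 2 * a" "z = Suc (2 * b)"
    | (oe) a b where "x = Suc (2 * a)" "z = 2 * b"
    using less.prems by (cases x rule: double_cases; cases z rule: double_cases) auto
  then show ?case
  proof cases
    case ee
    then have "c = Suc (2 * (a + b - 1))" "a + b = Suc (a + b - 1)" using less.prems by simp_all
    then obtain d where d: "c = Suc (2 * d)" "a + b = Suc d" by blast
    show ?thesis using less.IH [of d a b] less.prems d unfolding ee d nsplit_double by simp
  next
    case eo
    then have "c = 2 * (a + b)" using less.prems by simp
    then show ?thesis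
      using less.prems(1) eo nsplit_self_pos [of a b] by (simp only: nsplit_double disjoint_bits_double)
  next
    case oe
    then have "c = 2 * (a + b)" using less.prems by simp
    then show ?thesis
      using less.prems(1) oe nsplit_self_pos [of a b] by (simp only: nsplit_double disjoint_bits_double)
  qed
qed

text \<open>Each final zero of a positive y adds the positive term
  \<open>nsplit a b (a + b - 1)\<close>, a final one keeps the count, and the count starts at 1.
  Hence exactly two splittings leave at most one zero digit.\<close>

lemma zero_digits_le_nsplit: "disjoint_bits x z \<Longrightarrow> x + z = y \<Longrightarrow> zero_digits y < nsplit x z y"
proof (induction y arbitrary: x z rule: less_induct)
  case (less y)
  show ?case
  proof (cases "y = 0")
    case False
    consider (ee) a b where "x = 2 * a" "z = 2 * b" | (eo) a b where "x = 2 * a" "z = Suc (2 * b)"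
      | (oe) a b where "x = Suc (2 * a)" "z = 2 * b"
      using less.prems by (cases x rule: double_cases; cases z rule: double_cases) auto
    then show ?thesis
    proof cases
      case ee
      then have y: "y = 2 * (a + b)" using less.prems by simp
      with False have pos: "a + b > 0" by simp
      have dis: "disjoint_bits a b" using less.prems ee by simp
      have "zero_digits (a + b) < nsplit a b (a + b)" using less.IH [of "a + b" a b] dis y pos by auto
      moreover have "nsplit a b (a + b - 1) > 0" using nsplit_pred_pos [OF dis, of "a + b - 1"] pos by simp
      ultimately show ?thesis
        using pos unfolding ee y nsplit_double zero_digits_double(1) [OF pos] by simp
    next
      case eo
      then have y: "y = Suc (2 * (a + b))" using less.prems by simp
      have "disjoint_bits a b" "a + b < Suc (2 * (a + b))" using less.prems(1) eo by simp_all
      then show ?thesis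
        using less.IH [of "a + b" a b] unfolding eo y nsplit_double zero_digits_double by blast
    next
      case oe
      then have y: "y = Suc (2 * (a + b))" using less.prems by simp
      have "disjoint_bits a b" "a + b < Suc (2 * (a + b))" using less.prems(1) oe by simp_all
      then show ?thesis
        using less.IH [of "a + b" a b] unfolding oe y nsplit_double zero_digits_double by blast
    qed
  qed simp
qed

lemma zumkeller_iff: "zumkeller n \<longleftrightarrow> n > 0 \<and> zero_digits n \<le> 1"
  by (simp add: zumkeller_def zero_digits_def)

section \<open>The pattern of Ulam words with two ones\<close>

text \<open>The count 2 leaves one splitting after the one with equal halves is discarded. For y <
  M, the condition \<open>M \<le> y + 2\<close> singles out y = M - 1 and y = M - 2; in the block,
  only the latter keeps a line, x + z = M = y + 2.\<close>

definition gap_pattern :: "nat \<Rightarrow> nat \<Rightarrow> nat \<Rightarrow> nat \<Rightarrow> bool" where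
  "gap_pattern M y x z \<longleftrightarrow>
    (if x mod M + z mod M + 1 < M then x + z = y \<and> disjoint_bits x z \<and> nsplit x z y = 2
     else if M \<le> y + 2 \<and> x < M \<and> z < M then x + z = M \<and> y + 2 = M
     else odd (x mod M + z mod M) \<and> nsplit x z y = 1)"

lemma gap_pattern_commute: "gap_pattern M y x z \<longleftrightarrow> gap_pattern M y z x"
  by (auto simp: gap_pattern_def add.commute nsplit_commute disjoint_bits_commute)

lemma pred_mod:
  fixes x M :: nat
  assumes "M > 0" "x > 0"
  shows "(x - 1) mod M = (if x mod M = 0 then M - 1 else x mod M - 1)"
  using assms mod_Suc [of "x - 1" M] by (auto split: if_splits)

text \<open>This is the recursion of \<open>ulam_word_two_word\<close>, which determines its
  solution by induction on x + z.\<close>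

lemma gap_pattern_rec:
  fixes y k :: nat
  defines "M \<equiv> 2 ^ (k + 1)"
  assumes y: "2 ^ k \<le> y" "y < M"
  shows "gap_pattern M y x z \<longleftrightarrow>
    of_bool (x > 0 \<and> gap_pattern M y (x - 1) z) + of_bool (z > 0 \<and> gap_pattern M y x (z - 1))
      + (nsplit x z y - of_bool (x + z = y \<and> disjoint_bits x z)) = (1::nat)"
proof -
  let ?P = "gap_pattern M y"
  let ?L = "of_bool (x > 0 \<and> ?P (x - 1) z) :: nat" and ?R = "of_bool (z > 0 \<and> ?P x (z - 1)) :: nat"
  let ?c = "of_bool (x + z = y \<and> disjoint_bits x z) :: nat"
  have M: "M > 0" "even M" by (simp_all add: M_def)
  have "(2::nat) ^ k > 0" by simp
  then have y0: "y > 0" using y by linarith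
  have y2: "2 ^ k \<le> y" "y < 2 ^ (k + 1)" using y by (simp_all add: M_def)
  have nmod: "nsplit (u mod M) (v mod M) y = nsplit u v y" for u v
    unfolding M_def by (rule nsplit_mod) (use y2 in simp)
  have ltM: "u mod M < M" for u using M by simp
  have pm: "(u - 1) mod M = (if u mod M = 0 then M - 1 else u mod M - 1)" if "u > 0" for u
    using pred_mod [OF M(1) that] .
  have pos: "u > 0" if "u mod M > 0" for u using that by (cases u) auto
  have predlt: "u - 1 < M \<longleftrightarrow> u < M" if "u mod M > 0" for u
  proof -
    have "u \<noteq> M" using that by auto
    then show ?thesis using pos [OF that] by auto
  qed
  have zeroge: "u \<ge> M" if "u > 0" "u mod M = 0" for u
    using that by (metis mod_less not_less less_irrefl)
  have complement: "nsplit u v y = 1" if "u + v + 1 = M" for u v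
    using nsplit_complement [of u v "k + 1" y] that y2 by (simp add: M_def)
  have excess: "nsplit u v y = 0" if "u < M" "v < M" "u + v + y + 2 > 2 * M" for u v
    using nsplit_excess [of u "k + 1" v y] that y2 by (simp add: M_def)
  have tight: "nsplit u v y = 1" if "u < M" "v < M" "u + v + y + 2 = 2 * M" for u v
    using nsplit_tight [of u "k + 1" v y] that y2 by (simp add: M_def)
  have sym: "?P x (z - 1) \<longleftrightarrow> ?P (z - 1) x" by (rule gap_pattern_commute)
  \<comment> \<open>Equal indicators contribute an even number, so without splittings the total
    cannot be 1.\<close>
  have equal: "L + R + (N - c) \<noteq> 1" if "L = R" "N = 0" for L R N c :: nat
    using that by presburger
  consider (low) "x mod M + z mod M + 1 < M"
    | (exc) "x mod M + z mod M + 1 \<ge> M" "M \<le> y + 2" "x < M" "z < M"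
    | (regular) "x mod M + z mod M + 1 \<ge> M" "\<not> (M \<le> y + 2 \<and> x < M \<and> z < M)"
    by linarith
  then show ?thesis
  proof cases
    case low
    then have low': "z mod M + x mod M + 1 < M" by linarith
    have P: "?P x z \<longleftrightarrow> x + z = y \<and> disjoint_bits x z \<and> nsplit x z y = 2"
      using low by (simp add: gap_pattern_def)
    have Lpos: "?P (u - 1) v \<longleftrightarrow> u - 1 + v = y \<and> disjoint_bits (u - 1) v \<and> nsplit (u - 1) v y = 2"
      if "u mod M > 0" "u mod M + v mod M + 1 < M" for u v
    proof -
      have "(u - 1) mod M + v mod M + 1 < M" using that pm [OF pos [OF that(1)]] by simp
      then show ?thesis by (simp add: gap_pattern_def)
    qed
    have ne1: "nsplit x z y \<noteq> 1"
      using nsplit_low [of "x mod M" "z mod M" k y] low y2 nmod by (simp add: M_def)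
    show ?thesis
    proof (cases "nsplit x z y = 0")
      case True
      then have "nsplit (x mod M) (z mod M) y = 0" using nmod by simp
      \<comment> \<open>Without splittings both residues are positive, so neither neighbour wraps
        around modulo M and both stay in the low region.\<close>
      then have mods: "x mod M > 0" "z mod M > 0" using nsplit_eq_0_imp_pos by blast+
      then obtain x' z' where Suc: "x = Suc x'" "z = Suc z'"
        using pos by (meson gr0_implies_Suc)
      have L: "?P (x - 1) z \<longleftrightarrow> x' + z = y \<and> disjoint_bits x' z \<and> nsplit x' z y = 2"
        using Lpos [OF mods(1) low] unfolding Suc by simp
      have R: "?P (z - 1) x \<longleftrightarrow> z' + x = y \<and> disjoint_bits x z' \<and> nsplit x z' y = 2"
        using Lpos [OF mods(2) low'] unfolding Suc disjoint_bits_commute [of "Suc x'"] nsplit_commute [of "Suc x'"]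
        by simp
      have "x' + z = y \<longleftrightarrow> y = Suc (x' + z')" "z' + x = y \<longleftrightarrow> y = Suc (x' + z')"
        unfolding Suc by linarith+
      then have "?P (x - 1) z \<longleftrightarrow> ?P (z - 1) x"
        unfolding L R using nsplit_neighbours [of y x' z'] True unfolding Suc by blast
      then have "?L = ?R" unfolding sym using mods pos by simp
      from equal [OF this True] show ?thesis unfolding P using True by simp
    next
      case False
      then have ge2: "nsplit x z y \<ge> 2" using ne1 by linarith
      show ?thesis
      proof (cases "x + z = y \<and> disjoint_bits x z \<and> nsplit x z y = 2")
        case True
        \<comment> \<open>The neighbour has coordinate sum y - 1 and so misses the line of
          corrections.\<close>
        have "\<not> ?P (u - 1) v" if "u > 0" "u + v = y" "u mod M + v mod M + 1 < M" for u v
        proof -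
          have "u < M" using that y by linarith
          then have "u mod M > 0" using that(1) by simp
          moreover have "u - 1 + v \<noteq> y" using that(1,2) by linarith
          ultimately show ?thesis using Lpos that(3) by presburger
        qed
        note notP = this
        have "?L = 0" using notP [of x z] low True by (cases "x = 0") simp_all
        moreover have "?R = 0" unfolding sym using notP [of z x] low' True by (cases "z = 0") simp_all
        ultimately show ?thesis unfolding P using True by simp
      next
        case False
        \<comment> \<open>At least two splittings remain: one is discarded only where there are at
          least three.\<close>
        have "nsplit x z y - ?c \<noteq> 1 \<and> nsplit x z y - ?c > 0"
        proof (cases "x + z = y \<and> disjoint_bits x z")
          case True
          then have "nsplit x z y \<noteq> 2" using False by blast
          then show ?thesis using ge2 True by simp
        next
          case False
          then have "?c = 0" by simp
          then show ?thesis using ge2 by linarith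
        qed
        then have "?L + ?R + (nsplit x z y - ?c) \<noteq> 1" by linarith
        then show ?thesis unfolding P using False by blast
      qed
    qed
  next
    case exc
    then have mods: "x mod M = x" "z mod M = z" by simp_all
    have P: "?P u v \<longleftrightarrow> u + v = M \<and> y + 2 = M" if "u + v + 1 \<ge> M" "u < M" "v < M" for u v
      using that exc by (simp add: gap_pattern_def)
    consider "x + z + 1 = M" | "x + z = M" | "x + z > M" using exc mods by linarith
    then show ?thesis
    proof cases
      case 1
      then have eq': "z + x + 1 = M" by simp
      have N: "nsplit x z y = 1" using complement 1 .
      have notP: "\<not> ?P x z" using P 1 exc by simp
      have low: "?P (u - 1) v \<longleftrightarrow> u - 1 + v = y \<and> disjoint_bits (u - 1) v \<and> nsplit (u - 1) v y = 2"
        if "u + v + 1 = M" "u > 0" for u v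
        using that by (simp add: gap_pattern_def)
      consider "y + 1 = M" | "y + 2 = M" using exc y by linarith
      then show ?thesis
      proof cases
        case yM: 1
        \<comment> \<open>For y = M - 1 the single splitting is the one with equal halves, so
          nothing remains.\<close>
        have "disjoint_bits x z"
          using disjoint_bits_complement [of x z "k + 1"] 1 by (simp add: M_def)
        then have "?c = 1" using yM 1 by simp
        moreover have "\<not> ?P (u - 1) v" if "u + v + 1 = M" "u > 0" for u v
        proof -
          have "u - 1 + v \<noteq> y" using that yM by linarith
          then show ?thesis using low [OF that] by blast
        qed
        then have "?L = 0" "?R = 0" unfolding sym using 1 eq' by (cases "x = 0"; cases "z = 0"; simp)+
        ultimately show ?thesis using N notP by simp
      next
        case yM: 2
        \<comment> \<open>For y = M - 2, lowering an odd coordinate leads to a correction point,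
          where the recursion adds two counts of 1. As x + z = M - 1 is odd, such a neighbour
          exists, and together with the splitting the total exceeds 1.\<close>
        have odd: "?P (u - 1) v" if "odd u" "u + v + 1 = M" for u v
        proof -
          obtain a where a: "u = Suc (2 * a)" using \<open>odd u\<close> by (auto elim: oddE)
          have "even v" using that M(2) by presburger
          then obtain b where b: "v = 2 * b" by (auto elim: evenE)
          obtain c where c: "y = 2 * c" using yM M by (metis even_add even_numeral evenE)
          have ab: "a + b + 1 = 2 ^ k" "c + 1 = 2 ^ k"
            using that yM unfolding a b c M_def by simp_all
          have "nsplit a b n = 1" if "n \<le> c" for n
            using nsplit_complement [OF ab(1), of n] ab(2) that by simp
          then have "nsplit a b c = 1" "nsplit a b (c - 1) = 1" by simp_all
          moreover have "disjoint_bits a b" using disjoint_bits_complement ab(1) .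
          ultimately have "nsplit (2 * a) (2 * b) (2 * c) = 2 \<and> disjoint_bits (2 * a) (2 * b)"
            using y0 unfolding c nsplit_double disjoint_bits_double by simp
          then show ?thesis using low [of u v] that yM by (simp add: a b c)
        qed
        have "odd x \<or> odd z" using 1 M by presburger
        then have "?L = 1 \<or> ?R = 1"
        proof
          assume "odd x"
          then have "x > 0 \<and> ?P (x - 1) z" using odd [OF _ 1] odd_pos by blast
          then show ?thesis by simp
        next
          assume "odd z"
          then have "z > 0 \<and> ?P x (z - 1)" unfolding sym using odd [OF _ eq'] odd_pos by blast
          then show ?thesis by simp
        qed
        moreover have "?c = 0" using 1 yM by auto
        ultimately have "?L + ?R + (nsplit x z y - ?c) \<noteq> 1" using N by linarith
        then show ?thesis using notP by blast
      qed
    next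
      case 2
      then have xz: "x > 0" "z > 0" using exc by auto
      have "\<not> ?P (u - 1) v" if "u > 0" "u + v = M" "u < M" "v < M" for u v
      proof -
        have "u - 1 + v \<noteq> M" "u - 1 + v + 1 \<ge> M" "u - 1 < M" using that by linarith+
        then show ?thesis using P that(4) by blast
      qed
      note notP = this
      have L: "?L = 0" using notP [of x z] 2 exc by (cases "x = 0") simp_all
      have R: "?R = 0" unfolding sym using notP [of z x] 2 exc by (cases "z = 0") simp_all
      have c: "?c = 0" using 2 y by simp
      \<comment> \<open>On x + z = M the bound is attained for y = M - 2 and exceeded for y = M -
        1.\<close>
      have N: "nsplit x z y = of_bool (y + 2 = M)"
        using excess [of x z] tight [of x z] exc 2 y by auto
      have "?P x z \<longleftrightarrow> y + 2 = M" using P [of x z] exc 2 by simp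
      then show ?thesis unfolding L R c N by simp
    next
      case 3
      then have xz: "x > 0" "z > 0" using exc by linarith+
      have N: "nsplit x z y = 0" using excess [of x z] exc 3 by simp
      have "?P (x - 1) z \<longleftrightarrow> x - 1 + z = M \<and> y + 2 = M" "?P x (z - 1) \<longleftrightarrow> x + (z - 1) = M \<and> y + 2 = M"
        using 3 exc by (intro P; linarith)+
      moreover have "x - 1 + z = M \<longleftrightarrow> x + (z - 1) = M" using xz by linarith
      ultimately have "?L = ?R" using xz by simp
      from equal [OF this N] show ?thesis using P [of x z] 3 exc by simp
    qed
  next
    case regular
    then have regular': "\<not> (M \<le> y + 2 \<and> z < M \<and> x < M)" by blast
    have P: "?P u v \<longleftrightarrow> odd (u mod M + v mod M) \<and> nsplit u v y = 1"
      if "u mod M + v mod M + 1 \<ge> M" "\<not> (M \<le> y + 2 \<and> u < M \<and> v < M)" for u v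
    proof -
      have "\<not> u mod M + v mod M + 1 < M" using that(1) by linarith
      then show ?thesis unfolding gap_pattern_def using that(2) by (simp only: if_False)
    qed
    have noc: "?c = 0" if "x mod M + z mod M = x + z \<Longrightarrow> x + z \<noteq> y"
    proof -
      have "x + z \<noteq> y"
      proof
        assume eq: "x + z = y"
        then have "x < M" "z < M" using y by linarith+
        then have "x mod M + z mod M = x + z" by simp
        then show False using that eq by blast
      qed
      then show ?thesis by simp
    qed
    show ?thesis
    proof (cases "x mod M + z mod M + 1 = M")
      case True
      then have True': "z mod M + x mod M + 1 = M" by linarith
      have N: "nsplit x z y = 1" using complement [OF True] nmod by simp
      have left: "\<not> ?P (u - 1) v"
        if u: "u > 0" "u mod M + v mod M + 1 = M" "\<not> (M \<le> y + 2 \<and> u < M \<and> v < M)" for u v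
      proof (cases "u mod M = 0")
        case True
        \<comment> \<open>Wrapping around gives both residues the value M - 1, and their sum is
          even. Lying on the exceptional line would force M = 2 and y = 0.\<close>
        then have v: "(u - 1) mod M = M - 1" "v mod M = M - 1" using pm u by simp_all
        have "u - 1 \<ge> M - 1" using zeroge [OF u(1) True] by linarith
        moreover have "v \<ge> M - 1" using v(2) mod_less_eq_dividend [of v M] by simp
        ultimately have "\<not> (u - 1 + v = M \<and> y + 2 = M)" using y0 by linarith
        moreover have "even ((u - 1) mod M + v mod M)" unfolding v by simp
        moreover have "\<not> (u - 1) mod M + v mod M + 1 < M" unfolding v using M(1) by linarith
        ultimately show ?thesis
          unfolding gap_pattern_def
          by (cases "M \<le> y + 2 \<and> u - 1 < M \<and> v < M"; simp only: if_False if_True simp_thms)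
      next
        case False
        then have low: "(u - 1) mod M + v mod M + 1 < M" using pm [OF u(1)] u(2) by simp
        \<comment> \<open>A correction point here would have u + v = y + 1 = M - 1 inside the block,
          so y = M - 2, which is the excluded exception.\<close>
        have "u - 1 + v \<noteq> y"
        proof
          assume eq: "u - 1 + v = y"
          then have "u - 1 < M" "v < M" using y by linarith+
          then have "u < M" using predlt False by simp
          then have "u + v + 1 = M" using u(2) \<open>v < M\<close> by simp
          then have "M \<le> y + 2" using eq by linarith
          then show False using u(3) \<open>u < M\<close> \<open>v < M\<close> by blast
        qed
        then show ?thesis using low unfolding gap_pattern_def by simp
      qed
      have "?L = 0" using left [of x z] True regular(2) by (cases "x = 0") simp_all
      moreover have "?R = 0" unfolding sym using left [of z x] True' regular' by (cases "z = 0") simp_all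
      moreover have "?c = 0"
      proof (rule noc)
        assume "x mod M + z mod M = x + z"
        then have "x + z + 1 = M" "x \<le> x mod M + z mod M" using True by linarith+
        then have "x < M" "z < M" by linarith+
        then have "\<not> M \<le> y + 2" using regular(2) by blast
        then show "x + z \<noteq> y" using \<open>x + z + 1 = M\<close> by linarith
      qed
      moreover have "?P x z"
      proof -
        have "even (x mod M + z mod M + 1)" unfolding True using M(2) .
        then have "odd (x mod M + z mod M)" by simp
        then show ?thesis using P [OF regular] N by blast
      qed
      ultimately show ?thesis using N by simp
    next
      case False
      then have ge: "x mod M + z mod M \<ge> M" using regular by linarith
      then have mods: "x mod M > 0" "z mod M > 0" using ltM [of x] ltM [of z] by linarith+
      note pos = pos [OF mods(1)] pos [OF mods(2)]
      have c: "?c = 0" by (rule noc) (use ge y in linarith)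
      have left: "?P (u - 1) v \<longleftrightarrow> even (u mod M + v mod M) \<and> nsplit (u - 1) v y = 1"
        if u: "u mod M > 0" "u > 0" "u mod M + v mod M \<ge> M" "\<not> (M \<le> y + 2 \<and> u < M \<and> v < M)" for u v
      proof -
        have "(u - 1) mod M = u mod M - 1" using pm [OF u(2)] u(1) by simp
        then have eq: "(u - 1) mod M + v mod M + 1 = u mod M + v mod M" using u(1) by linarith
        have *: "(u - 1) mod M + v mod M + 1 \<ge> M" using u(3) unfolding eq .
        have parity: "odd ((u - 1) mod M + v mod M) \<longleftrightarrow> even (u mod M + v mod M)"
          unfolding eq [symmetric] by simp
        have "\<not> (M \<le> y + 2 \<and> u - 1 < M \<and> v < M)" using u(4) predlt [OF u(1)] by blast
        then show ?thesis using P [OF *] parity by blast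
      qed
      have L: "?P (x - 1) z \<longleftrightarrow> even (x mod M + z mod M) \<and> nsplit (x - 1) z y = 1"
        using left [OF mods(1) pos(1) ge regular(2)] .
      have R: "?P x (z - 1) \<longleftrightarrow> even (x mod M + z mod M) \<and> nsplit x (z - 1) y = 1"
        unfolding sym nsplit_commute [of x "z - 1"]
        using left [OF mods(2) pos(2) _ regular'] ge by (simp only: add.commute [of "z mod M" "x mod M"])
      have even: "even (x mod M + z mod M) \<longleftrightarrow> even (x + z)"
        using M(2) by (simp add: dvd_mod_iff)
      show ?thesis
      proof (cases "even (x + z)")
        case True
        then show ?thesis
          using P [OF regular] nsplit_even_sum [OF pos y0 True] pos unfolding L R even c by simp
      next
        \<comment> \<open>Both neighbours have even residue sums and drop out; the total is the
          number of splittings.\<close>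
        case False
        then show ?thesis using P [OF regular] pos unfolding L R even c by simp
      qed
    qed
  qed
qed

section \<open>Ulam words\<close>

lemma length_ulam_level:
  assumes "w \<in> ulam_level n"
  shows "length w = n" "n > 0"
  using assms unfolding ulam_level.simps [of n] by (auto split: if_splits)

lemma ulam_word_iff_level: "ulam_word w \<longleftrightarrow> w \<in> ulam_level (length w)"
proof -
  have "w \<in> ulam_level n \<Longrightarrow> n \<ge> 1 \<and> n = length w" for n
    using length_ulam_level [of w n] by auto
  then show ?thesis unfolding ulam_word_def by blast
qed

definition ulam_splits :: "word \<Rightarrow> (word \<times> word) set" where
  "ulam_splits w = {(u, v). w = u @ v \<and> u \<noteq> v \<and> ulam_word u \<and> ulam_word v}"

text \<open>The bounds on the levels are automatic: Ulam words are nonempty, so both factors are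
  shorter than w. Cardinality in place of unique existence allows counting factorizations by
  kind.\<close>

lemma ulam_word_iff:
  "ulam_word w \<longleftrightarrow> length w = 1 \<or> length w > 1 \<and> card (ulam_splits w) = 1"
proof -
  let ?n = "length w"
  have lower: "(\<exists>i\<in>{..<n}. u \<in> ulam_level i) \<longleftrightarrow> ulam_word u \<and> length u < n" for u n
    unfolding ulam_word_iff_level using length_ulam_level by (auto intro!: bexI [of _ "length u"])
  have nonempty: "length u > 0" if "ulam_word u" for u
    using that length_ulam_level unfolding ulam_word_iff_level by blast
  have split: "(\<lambda>p. case p of (u, v) \<Rightarrow> w = u @ v \<and> u \<noteq> v \<and>
      (\<exists>i\<in>{..<?n}. u \<in> ulam_level i) \<and> (\<exists>j\<in>{..<?n}. v \<in> ulam_level j)) = (\<lambda>p. p \<in> ulam_splits w)"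
    unfolding lower ulam_splits_def by (rule ext) (auto dest: nonempty)
  have unique: "(\<exists>!p. p \<in> S) \<longleftrightarrow> card S = 1" for S :: "(word \<times> word) set"
    unfolding One_nat_def card_1_singleton_iff by blast
  have single: "w \<in> {[False], [True]} \<longleftrightarrow> ?n = 1"
    by (cases w) (auto simp: length_Suc_conv)
  have "ulam_level 0 = {}" "ulam_level 1 = {[False], [True]}"
    by (subst ulam_level.simps, simp)+
  moreover have "w \<in> ulam_level ?n \<longleftrightarrow> card (ulam_splits w) = 1" if "?n > 1"
  proof -
    have "\<not> ?n = 0" "\<not> ?n = 1" using that by linarith+
    then have "w \<in> ulam_level ?n \<longleftrightarrow> length w = ?n \<and>
        (\<exists>!p. case p of (u, v) \<Rightarrow> w = u @ v \<and> u \<noteq> v \<and>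
          (\<exists>i\<in>{..<?n}. u \<in> ulam_level i) \<and> (\<exists>j\<in>{..<?n}. v \<in> ulam_level j))"
      by (subst ulam_level.simps) (simp only: if_False mem_Collect_eq)
    then show ?thesis by (simp only: split unique simp_thms)
  qed
  ultimately show ?thesis
    unfolding ulam_word_iff_level [of w] using single
    by (metis One_nat_def empty_iff less_one linorder_neqE_nat)
qed

lemma not_ulam_word_Nil: "\<not> ulam_word []"
  by (simp add: ulam_word_iff)

text \<open>The cut lies either strictly before the end of the block or at its end or later; the
  strict bound on i keeps the alternatives apart.\<close>

lemma append_eq_replicate_append:
  "u @ v = replicate a x @ s \<longleftrightarrow>
    (\<exists>i<a. u = replicate i x \<and> v = replicate (a - i) x @ s) \<or>
    (\<exists>u'. u = replicate a x @ u' \<and> u' @ v = s)"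
proof (induction a arbitrary: u)
  case 0
  then show ?case by simp
next
  case (Suc a)
  show ?case
  proof (cases u)
    case Nil
    then show ?thesis by auto
  next
    case (Cons y u1)
    have "(\<exists>i<Suc a. u = replicate i x \<and> v = replicate (Suc a - i) x @ s) \<longleftrightarrow>
        y = x \<and> (\<exists>i<a. u1 = replicate i x \<and> v = replicate (a - i) x @ s)"
      unfolding Cons by (subst Ex_less_Suc2) auto
    then show ?thesis using Suc.IH [of u1] Cons by auto
  qed
qed

lemma append_eq_replicate:
  "u @ v = replicate b x \<longleftrightarrow> (\<exists>i\<le>b. u = replicate i x \<and> v = replicate (b - i) x)"
  using append_eq_replicate_append [of u v b x "[]"] by (auto simp: order_le_less)

text \<open>For n > 1 both factors would, by induction, be the word 0, but they must be
  distinct.\<close>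

lemma ulam_word_zeros: "ulam_word (replicate n False) \<longleftrightarrow> n = 1"
proof (induction n rule: less_induct)
  case (less n)
  have "ulam_splits (replicate n False) = {}" if "n > 1"
  proof -
    have False if "(u, v) \<in> ulam_splits (replicate n False)" for u v
    proof -
      have uv: "u @ v = replicate n False" "u \<noteq> v" "ulam_word u" "ulam_word v"
        using that by (auto simp: ulam_splits_def)
      then obtain i where i: "i \<le> n" "u = replicate i False" "v = replicate (n - i) False"
        by (auto simp: append_eq_replicate)
      have "i \<noteq> 0" using uv(3) i(2) not_ulam_word_Nil by (metis replicate_0)
      moreover have "n - i \<noteq> 0" using uv(4) i(3) not_ulam_word_Nil by (metis replicate_0)
      ultimately have "i = 1" "n - i = 1"
        using uv i less.IH [of i] less.IH [of "n - i"] by simp_all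
      then show False using uv i by simp
    qed
    then show ?thesis by auto
  qed
  then show ?case by (auto simp: ulam_word_iff [of "replicate n False"])
qed

section \<open>Words with one or two ones\<close>

definition one_word :: "nat \<Rightarrow> nat \<Rightarrow> word" where
  "one_word a b = replicate a False @ True # replicate b False"

definition two_word :: "nat \<Rightarrow> nat \<Rightarrow> nat \<Rightarrow> word" where
  "two_word x y z = replicate x False @ True # replicate y False @ True # replicate z False"

lemma True_in_words [simp]: "True \<in> set (one_word a b)" "True \<in> set (two_word x y z)"
  by (simp_all add: one_word_def two_word_def)

lemma one_word_inject [simp]: "one_word a b = one_word c d \<longleftrightarrow> a = c \<and> b = d"
proof -
  have "takeWhile Not (one_word a b) = replicate a False" for a b
    by (simp add: one_word_def takeWhile_append)
  moreover have "length (one_word a b) = a + b + 1" for a b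
    by (simp add: one_word_def)
  ultimately show ?thesis
    by (metis add_left_imp_eq add_right_imp_eq length_replicate)
qed

lemma Cons_split: "(\<exists>u'. u = r @ u' \<and> u' @ v = x # t) \<longleftrightarrow>
    (u = r \<and> v = x # t) \<or> (\<exists>u'. u = r @ x # u' \<and> u' @ v = t)"
  by (auto simp: append_eq_Cons_conv)

lemma append_eq_one_word:
  "u @ v = one_word a b \<longleftrightarrow>
    (\<exists>i\<le>a. u = replicate i False \<and> v = one_word (a - i) b) \<or>
    (\<exists>i\<le>b. u = one_word a i \<and> v = replicate (b - i) False)"
  unfolding one_word_def append_eq_replicate_append Cons_split append_eq_replicate
  by (auto simp: order_le_less)

lemma append_eq_two_word:
  "u @ v = two_word x y z \<longleftrightarrow>
    (\<exists>i\<le>x. u = replicate i False \<and> v = two_word (x - i) y z) \<or>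
    (\<exists>i\<le>y. u = one_word x i \<and> v = one_word (y - i) z) \<or>
    (\<exists>i\<le>z. u = two_word x y i \<and> v = replicate (z - i) False)"
proof -
  have "(\<exists>u'. u = replicate x False @ True # u' \<and> u' @ v = replicate y False @ True # replicate z False) \<longleftrightarrow>
    (\<exists>i\<le>y. u = one_word x i \<and> v = one_word (y - i) z) \<or>
    (\<exists>i\<le>z. u = two_word x y i \<and> v = replicate (z - i) False)"
    using append_eq_one_word [of _ v y z]
    unfolding one_word_def two_word_def by (auto; metis)
  then show ?thesis
    unfolding two_word_def append_eq_replicate_append Cons_split [of _ "replicate x False"]
    by (auto simp: order_le_less)
qed

text \<open>Among the cuts inside the leading zeros only the prefix 0 is Ulam. The function
  \<open>f\<close> stands for the remaining word, with one or two ones.\<close>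

lemma ulam_word_left_zeros:
  "(\<exists>i\<le>n. u = replicate i False \<and> v = f i) \<and> ulam_word u \<longleftrightarrow> n \<ge> 1 \<and> u = [False] \<and> v = f 1"
    (is "?lhs \<longleftrightarrow> ?rhs")
proof
  assume ?lhs
  then obtain i where i: "i \<le> n" "u = replicate i False" "v = f i" "ulam_word (replicate i False)"
    by blast
  then have "i = 1" by (simp only: ulam_word_zeros)
  with i show ?rhs by simp
next
  assume rhs: ?rhs
  then have u: "u = replicate 1 False" by simp
  have "ulam_word u" unfolding u ulam_word_zeros ..
  with rhs u show ?lhs by blast
qed

lemma ulam_word_right_zeros:
  "(\<exists>i\<le>n. u = f i \<and> v = replicate (n - i) False) \<and> ulam_word v \<longleftrightarrow>
    n \<ge> 1 \<and> u = f (n - 1) \<and> v = [False]" (is "?lhs \<longleftrightarrow> ?rhs")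
proof
  assume ?lhs
  then obtain i where i: "i \<le> n" "u = f i" "v = replicate (n - i) False" "ulam_word (replicate (n - i) False)"
    by blast
  then have "n - i = 1" by (simp only: ulam_word_zeros)
  moreover from this i(1) have "i = n - 1" "n \<ge> 1" by linarith+
  ultimately show ?rhs using i by simp
next
  assume rhs: ?rhs
  then have v: "v = replicate 1 False" by simp
  have "ulam_word v" unfolding v ulam_word_zeros ..
  moreover have "n - 1 \<le> n" "n - (n - 1) = 1" using rhs by linarith+
  ultimately show ?lhs using rhs v by metis
qed

lemma card_if_singleton: "card (if P then {p} else {}) = of_bool P"
  by simp

text \<open>A factor without a 1 must be the word 0, so only removing a zero at either end is
  possible. Uniqueness says that exactly one of the shorter words is Ulam, which is
  \<open>disjoint_bits_pascal\<close>.\<close>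

lemma ulam_word_one_word: "ulam_word (one_word a b) \<longleftrightarrow> disjoint_bits a b"
proof (induction "a + b" arbitrary: a b rule: less_induct)
  case less
  let ?A = "if a > 0 \<and> ulam_word (one_word (a - 1) b) then {([False], one_word (a - 1) b)} else {}"
  let ?B = "if b > 0 \<and> ulam_word (one_word a (b - 1)) then {(one_word a (b - 1), [False])} else {}"
  have no_True: "True \<notin> set [False]" by simp
  have ne: "[False] \<noteq> one_word c d" "one_word c d \<noteq> [False]" for c d
    using True_in_words(1) no_True by metis+
  have length: "length (one_word a b) = Suc (a + b)" by (simp add: one_word_def)
  have "ulam_splits (one_word a b) = ?A \<union> ?B"
  proof (rule set_eqI)
    fix p :: "word \<times> word"
    obtain u v where p: "p = (u, v)" by force
    have "p \<in> ulam_splits (one_word a b) \<longleftrightarrow>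
      ((\<exists>i\<le>a. u = replicate i False \<and> v = one_word (a - i) b) \<or>
       (\<exists>i\<le>b. u = one_word a i \<and> v = replicate (b - i) False)) \<and> u \<noteq> v \<and> ulam_word u \<and> ulam_word v"
      unfolding append_eq_one_word [symmetric] by (auto simp: p ulam_splits_def)
    also have "\<dots> \<longleftrightarrow> a \<ge> 1 \<and> u = [False] \<and> v = one_word (a - 1) b \<and> ulam_word v \<or>
      b \<ge> 1 \<and> u = one_word a (b - 1) \<and> v = [False] \<and> ulam_word u"
      using ulam_word_left_zeros [where u = u and v = v and n = a and f = "\<lambda>i. one_word (a - i) b"]
        ulam_word_right_zeros [where u = u and v = v and n = b and f = "one_word a"] ne by blast
    also have "\<dots> \<longleftrightarrow> p \<in> ?A \<union> ?B" by (auto simp: p)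
    finally show "p \<in> ulam_splits (one_word a b) \<longleftrightarrow> p \<in> ?A \<union> ?B" .
  qed
  moreover have "?A \<inter> ?B = {}" using ne by auto
  ultimately have "card (ulam_splits (one_word a b)) =
      of_bool (a > 0 \<and> ulam_word (one_word (a - 1) b)) + of_bool (b > 0 \<and> ulam_word (one_word a (b - 1)))"
    by (simp add: card_Un_disjoint card_if_singleton del: if_split)
  then have "ulam_word (one_word a b) \<longleftrightarrow> a + b = 0 \<or> a + b > 0 \<and>
      of_bool (a > 0 \<and> disjoint_bits (a - 1) b) + of_bool (b > 0 \<and> disjoint_bits a (b - 1)) = (1::nat)"
    using less.hyps [of "a - 1" b] less.hyps [of a "b - 1"] length
    unfolding ulam_word_iff [of "one_word a b"] by (simp cong: conj_cong)
  also have "\<dots> \<longleftrightarrow> disjoint_bits a b"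
    using disjoint_bits_pascal [of a b] by (cases "a = 0"; cases "b = 0") (auto simp: of_bool_def)
  finally show ?case .
qed

lemma ulam_word_two_word:
  "ulam_word (two_word x y z) \<longleftrightarrow>
    of_bool (x > 0 \<and> ulam_word (two_word (x - 1) y z)) + of_bool (z > 0 \<and> ulam_word (two_word x y (z - 1)))
      + (nsplit x z y - of_bool (x + z = y \<and> disjoint_bits x z)) = (1::nat)"
proof -
  let ?A = "if x > 0 \<and> ulam_word (two_word (x - 1) y z) then {([False], two_word (x - 1) y z)} else {}"
  let ?B = "if z > 0 \<and> ulam_word (two_word x y (z - 1)) then {(two_word x y (z - 1), [False])} else {}"
  let ?J = "{i. i \<le> y \<and> disjoint_bits x i \<and> disjoint_bits z (y - i)}"
  \<comment> \<open>The two halves coincide exactly for i = z and y - i = x; this i belongs to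
    \<open>?J\<close> when x and z are disjoint.\<close>
  let ?I = "?J - (if x + z = y \<and> disjoint_bits x z then {z} else {})"
  let ?f = "\<lambda>i. (one_word x i, one_word (y - i) z)"
  have no_True: "True \<notin> set [False]" by simp
  have ne: "[False] \<noteq> two_word x y z" "two_word x y z \<noteq> [False]" "[False] \<noteq> one_word c d" "one_word c d \<noteq> [False]" for x y z c d
    using True_in_words no_True by metis+
  have mem: "i \<in> ?I \<longleftrightarrow> i \<le> y \<and> one_word x i \<noteq> one_word (y - i) z \<and>
      ulam_word (one_word x i) \<and> ulam_word (one_word (y - i) z)" for i
    using disjoint_bits_commute [of z "y - i"]
    by (cases "x + z = y \<and> disjoint_bits x z"; cases "i = z") (auto simp: ulam_word_one_word)
  have "ulam_splits (two_word x y z) = (?A \<union> ?B) \<union> ?f ` ?I"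
  proof (rule set_eqI)
    fix p :: "word \<times> word"
    obtain u v where p: "p = (u, v)" by force
    have "p \<in> ulam_splits (two_word x y z) \<longleftrightarrow>
      ((\<exists>i\<le>x. u = replicate i False \<and> v = two_word (x - i) y z) \<or>
       (\<exists>i\<le>y. u = one_word x i \<and> v = one_word (y - i) z) \<or>
       (\<exists>i\<le>z. u = two_word x y i \<and> v = replicate (z - i) False)) \<and> u \<noteq> v \<and> ulam_word u \<and> ulam_word v"
      unfolding append_eq_two_word [symmetric] by (auto simp: p ulam_splits_def)
    also have "\<dots> \<longleftrightarrow> (x \<ge> 1 \<and> u = [False] \<and> v = two_word (x - 1) y z \<and> ulam_word v \<or>
      z \<ge> 1 \<and> u = two_word x y (z - 1) \<and> v = [False] \<and> ulam_word u) \<or>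
      (\<exists>i\<le>y. u = one_word x i \<and> v = one_word (y - i) z \<and> u \<noteq> v \<and> ulam_word u \<and> ulam_word v)"
      using ulam_word_left_zeros [where u = u and v = v and n = x and f = "\<lambda>i. two_word (x - i) y z"]
        ulam_word_right_zeros [where u = u and v = v and n = z and f = "two_word x y"] ne(1,2) by blast
    also have "(\<exists>i\<le>y. u = one_word x i \<and> v = one_word (y - i) z \<and> u \<noteq> v \<and> ulam_word u \<and> ulam_word v) \<longleftrightarrow>
      p \<in> ?f ` ?I"
      unfolding p using mem by blast
    also have "x \<ge> 1 \<and> u = [False] \<and> v = two_word (x - 1) y z \<and> ulam_word v \<or>
      z \<ge> 1 \<and> u = two_word x y (z - 1) \<and> v = [False] \<and> ulam_word u \<longleftrightarrow> p \<in> ?A \<union> ?B"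
      by (auto simp: p)
    finally show "p \<in> ulam_splits (two_word x y z) \<longleftrightarrow> p \<in> (?A \<union> ?B) \<union> ?f ` ?I" by simp
  qed
  moreover have "?A \<inter> ?B = {}" "(?A \<union> ?B) \<inter> ?f ` ?I = {}"
  proof -
    have "?A \<subseteq> {([False], two_word (x - 1) y z)}" "?B \<subseteq> {(two_word x y (z - 1), [False])}" by simp_all
    then show "?A \<inter> ?B = {}" "(?A \<union> ?B) \<inter> ?f ` ?I = {}" using ne by fast+
  qed
  moreover have "card (?f ` ?I) = card ?I" by (intro card_image) (auto simp: inj_on_def)
  moreover have "card ?I = nsplit x z y - of_bool (x + z = y \<and> disjoint_bits x z)"
    unfolding nsplit_def by (subst card_Diff_subset) (auto simp: disjoint_bits_commute)
  moreover have "finite ?A" "finite ?B" "finite ?I" by simp_all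
  ultimately have "card (ulam_splits (two_word x y z)) =
      of_bool (x > 0 \<and> ulam_word (two_word (x - 1) y z)) + of_bool (z > 0 \<and> ulam_word (two_word x y (z - 1)))
      + (nsplit x z y - of_bool (x + z = y \<and> disjoint_bits x z))"
    by (simp only: card_Un_disjoint card_if_singleton finite_Un finite_imageI simp_thms)
  then show ?thesis
    by (subst ulam_word_iff) (simp add: two_word_def)
qed

lemma Ulam_iff:
  assumes "2 ^ k \<le> y" "y < 2 ^ (k + 1)"
  shows "(x, z) \<in> Ulam y \<longleftrightarrow> gap_pattern (2 ^ (k + 1)) y x z"
proof -
  have "ulam_word (two_word x y z) \<longleftrightarrow> gap_pattern (2 ^ (k + 1)) y x z"
  proof (induction "x + z" arbitrary: x z rule: less_induct)
    case less
    then have "x > 0 \<Longrightarrow> ulam_word (two_word (x - 1) y z) \<longleftrightarrow> gap_pattern (2 ^ (k + 1)) y (x - 1) z"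
      "z > 0 \<Longrightarrow> ulam_word (two_word x y (z - 1)) \<longleftrightarrow> gap_pattern (2 ^ (k + 1)) y x (z - 1)"
      by simp_all
    then show ?case
      unfolding ulam_word_two_word [of x y z] gap_pattern_rec [OF assms, of x z] by (simp cong: conj_cong)
  qed
  then show ?thesis by (simp add: Ulam_def two_word_def)
qed

section \<open>From the pattern to the assertions of the theorem\<close>

lemma int_cong_minus_1_iff:
  fixes n :: nat
  assumes "M > 0"
  shows "[int n = - 1] (mod int M) \<longleftrightarrow> n mod M + 1 = M"
proof -
  have "[int n = - 1] (mod int M) \<longleftrightarrow> int M dvd int n + 1" by (simp add: cong_iff_dvd_diff)
  also have "\<dots> \<longleftrightarrow> M dvd Suc n" using of_nat_dvd_iff [of M "Suc n", where ?'a = int] by (simp add: add.commute)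
  also have "\<dots> \<longleftrightarrow> n mod M + 1 = M" using assms by (auto simp: dvd_eq_mod_eq_0 mod_Suc)
  finally show ?thesis .
qed

text \<open>Exactly one of x and z is odd, so halving merely drops the last digits and reaches the
  equality case \<open>nsplit_tight\<close> one digit lower.\<close>

lemma nsplit_tight_odd:
  assumes "x < 2 ^ (k + 1)" "z < 2 ^ (k + 1)" "y < 2 ^ (k + 1)" "even y" "x + z + y + 3 = 2 * 2 ^ (k + 1)"
  shows "nsplit x z y = 1"
proof -
  obtain c where c: "y = 2 * c" using assms by (auto elim: evenE)
  have "odd (x + z)" using assms by presburger
  then consider (oe) a b where "x = Suc (2 * a)" "z = 2 * b" | (eo) a b where "x = 2 * a" "z = Suc (2 * b)"
    by (cases x rule: double_cases; cases z rule: double_cases) auto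
  then show ?thesis
  proof cases
    case oe
    show ?thesis using assms unfolding c oe nsplit_double by (intro nsplit_tight [of a k]) simp_all
  next
    case eo
    show ?thesis using assms unfolding c eo nsplit_double by (intro nsplit_tight [of a k]) simp_all
  qed
qed

lemma Ulam_imp:
  assumes k: "2 ^ k \<le> y" "y < 2 ^ (k + 1)" and xz: "(x, z) \<in> Ulam y"
  defines "M \<equiv> 2 ^ (k + 1)"
  shows "x mod M + z mod M + 1 < M \<Longrightarrow> x + z = y \<and> zumkeller y"
    and "x mod M + z mod M + y + 2 \<le> 2 * M"
proof -
  have P: "gap_pattern M y x z" using Ulam_iff [OF k] xz by (simp add: M_def)
  have "(2::nat) ^ k > 0" by simp
  then have y: "y > 0" "y < M" using k by (simp_all only: M_def)
  show "x + z = y \<and> zumkeller y" if "x mod M + z mod M + 1 < M"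
  proof -
    have "x + z = y" "disjoint_bits x z" "nsplit x z y = 2" using P that by (simp_all add: gap_pattern_def)
    then show ?thesis using zero_digits_le_nsplit [of x z y] y by (simp add: zumkeller_iff)
  qed
  show "x mod M + z mod M + y + 2 \<le> 2 * M"
  proof (rule ccontr)
    assume *: "\<not> ?thesis"
    have lt: "x mod M < 2 ^ (k + 1)" "z mod M < 2 ^ (k + 1)" by (simp_all add: M_def)
    have "nsplit (x mod M) (z mod M) y = 0"
      using nsplit_excess [OF lt k(2)] * by (simp only: M_def)
    then have "nsplit x z y = 0" using nsplit_mod [OF k(2)] by (simp add: M_def)
    \<comment> \<open>Without splittings only the exceptional line is left, and there the bound
      holds with equality.\<close>
    then have "x < M" "z < M" "x + z = M" "y + 2 = M" using P y * by (auto simp: gap_pattern_def split: if_splits)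
    then show False using * by simp
  qed
qed

text \<open>The second value of the residue sum is the largest odd number up to 2M - y - 2. It is 2M
  - y - 2 for odd y and 2M - y - 3 for even y, matching \<open>nsplit_tight\<close> and
  \<open>nsplit_tight_odd\<close>.\<close>

lemma Ulam_if:
  assumes k: "2 ^ k \<le> y" "y < 2 ^ (k + 1)"
  defines "M \<equiv> 2 ^ (k + 1)"
  assumes exc: "M \<le> y + 2 \<Longrightarrow> x + z + 1 \<noteq> M"
    and xz: "x mod M + z mod M + 1 = M \<or> x mod M + z mod M = 2 * ((2 * M - y - 3) div 2) + 1"
  shows "(x, z) \<in> Ulam y"
proof -
  have y: "y < M" "even M" using k by (simp_all add: M_def)
  have lt: "x mod M < 2 ^ (k + 1)" "z mod M < 2 ^ (k + 1)" by (simp_all add: M_def)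
  note ltM = lt [folded M_def]
  have nmod: "nsplit (x mod M) (z mod M) y = nsplit x z y" using nsplit_mod [OF k(2)] by (simp add: M_def)
  define s where "s = x mod M + z mod M"
  have "y + 3 \<le> 2 * M" using y by presburger
  then obtain d where d: "2 * M = y + 3 + d" by (metis le_Suc_ex)
  then have "2 * M - y - 3 = d" by simp
  then have xz: "s + 1 = M \<or> s = 2 * (d div 2) + 1" using xz by (simp only: s_def)
  then have odd: "odd s" using y(2) by presburger
  have eq: "s + 1 = M \<or> odd y \<and> s + y + 2 = 2 * M \<or> even y \<and> s + y + 3 = 2 * M"
    using xz d by presburger
  have "nsplit (x mod M) (z mod M) y = 1"
    using eq
  proof (elim disjE conjE)
    assume "s + 1 = M"
    then show ?thesis using nsplit_complement [of "x mod M" "z mod M" "k + 1" y] k(2)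
      by (simp only: M_def s_def)
  next
    assume "s + y + 2 = 2 * M"
    then show ?thesis using nsplit_tight [OF lt k(2)] by (simp only: M_def s_def)
  next
    assume "even y" "s + y + 3 = 2 * M"
    then show ?thesis using nsplit_tight_odd [OF lt k(2)] by (simp only: M_def s_def)
  qed
  then have one: "nsplit x z y = 1" using nmod by simp
  have ge: "s + 1 \<ge> M" using eq y by presburger
  have regular: "\<not> (M \<le> y + 2 \<and> x < M \<and> z < M)"
  proof
    assume *: "M \<le> y + 2 \<and> x < M \<and> z < M"
    then have "s = x + z" by (simp add: s_def)
    \<comment> \<open>For y = M - 1 and y = M - 2 both lines of the hypothesis are s = M -
      1.\<close>
    moreover have "s + 1 = M" using eq y * by presburger
    ultimately show False using exc * by simp
  qed
  have "gap_pattern M y x z" using ge regular odd one unfolding s_def by (auto simp: gap_pattern_def)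
  then show ?thesis using Ulam_iff [OF k] by (simp add: M_def)
qed

theorem proposition1p13:
  fixes y k :: nat
  assumes "y \<ge> 1" and "2 ^ k \<le> y" and "y < 2 ^ (k + 1)"
  shows
    "((\<exists>(x, z) \<in> Ulam y. x + z < 2 ^ (k + 1) - 1) \<longrightarrow> zumkeller y) \<and>
     (\<not> zumkeller y \<longrightarrow>
        (\<forall>(x, z) \<in> Ulam y.
           2 ^ (k + 1) - 1 \<le> x mod 2 ^ (k + 1) + z mod 2 ^ (k + 1) \<and>
           x mod 2 ^ (k + 1) + z mod 2 ^ (k + 1) \<le> 2 ^ (k + 2) - y - 2)) \<and>
     (zumkeller y \<longrightarrow>
        (\<forall>(x, z) \<in> Ulam y. x + z \<notin> {y, y + 1, y + 2} \<longrightarrow>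
           2 ^ (k + 1) - 1 \<le> x mod 2 ^ (k + 1) + z mod 2 ^ (k + 1) \<and>
           x mod 2 ^ (k + 1) + z mod 2 ^ (k + 1) \<le> 2 ^ (k + 2) - y - 2)) \<and>
     (y \<notin> {2 ^ (k + 1) - 1, 2 ^ (k + 1) - 2} \<longrightarrow>
        (\<forall>x z :: nat.
           [int (x + z) = - 1] (mod 2 ^ (k + 1)) \<or>
           x mod 2 ^ (k + 1) + z mod 2 ^ (k + 1) = 2 * ((2 ^ (k + 2) - y - 3) div 2) + 1
           \<longrightarrow> (x, z) \<in> Ulam y)) \<and>
     (y \<in> {2 ^ (k + 1) - 1, 2 ^ (k + 1) - 2} \<longrightarrow>
        (\<forall>x z :: nat. x + z \<noteq> 2 ^ (k + 1) - 1 \<longrightarrow>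
           [int (x + z) = - 1] (mod 2 ^ (k + 1)) \<or>
           x mod 2 ^ (k + 1) + z mod 2 ^ (k + 1) = 2 * ((2 ^ (k + 2) - y - 3) div 2) + 1
           \<longrightarrow> (x, z) \<in> Ulam y))"
proof -
  define M :: nat where "M = 2 ^ (k + 1)"
  have M: "2 ^ (k + 1) = M" "2 ^ (k + 2) = 2 * M" "(2::int) ^ (k + 1) = int M"
    by (simp_all add: M_def)
  have "M > 0" by (simp add: M_def)
  note y = assms(2,3)
  have yM: "y < M" using y(2) by (simp only: M)
  have imp: "x mod M + z mod M + 1 < M \<Longrightarrow> x + z = y \<and> zumkeller y"
    "x mod M + z mod M + y + 2 \<le> 2 * M" if "(x, z) \<in> Ulam y" for x z
    using Ulam_imp [OF y that] by (simp_all only: M)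
  have if': "(x, z) \<in> Ulam y"
    if "M \<le> y + 2 \<Longrightarrow> x + z + 1 \<noteq> M"
      and "[int (x + z) = - 1] (mod int M) \<or> x mod M + z mod M = 2 * ((2 * M - y - 3) div 2) + 1" for x z
  proof (rule Ulam_if [OF y, unfolded M])
    have "x mod M + z mod M + 1 = M" if "[int (x + z) = - 1] (mod int M)"
    proof -
      have "(x mod M + z mod M) mod M + 1 = M"
        using that int_cong_minus_1_iff [OF \<open>M > 0\<close>] by (simp only: mod_add_eq)
      moreover have "x mod M < M" "z mod M < M" using \<open>M > 0\<close> by simp_all
      \<comment> \<open>Two residues add up to at most 2M - 2, so a sum congruent to -1 is M - 1
        itself.\<close>
      moreover have "a + b + 1 = M" if "(a + b) mod M + 1 = M" "a < M" "b < M" for a b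
        using that by (cases "a + b < M") (auto simp: le_mod_geq not_less)
      ultimately show ?thesis by blast
    qed
    then show "x mod M + z mod M + 1 = M \<or> x mod M + z mod M = 2 * ((2 * M - y - 3) div 2) + 1"
      using that(2) by blast
  qed (use that(1) in blast)
  \<comment> \<open>These equivalences and the next ones replace truncated subtractions by
    additions, which is sound for 1 <= y < M.\<close>
  have exc: "y \<in> {M - 1, M - 2} \<longleftrightarrow> M \<le> y + 2" "x + z = M - 1 \<longleftrightarrow> x + z + 1 = M" for x z
    using yM assms(1) by auto
  have bounds: "M - 1 \<le> s \<and> s \<le> 2 * M - y - 2 \<longleftrightarrow> \<not> s + 1 < M \<and> s + y + 2 \<le> 2 * M"
    "s < M - 1 \<longleftrightarrow> s + 1 < M" for s
    using yM assms(1) by auto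
  have small: "x mod M + z mod M + 1 < M" if "x + z + 1 < M" for x z
    using that by simp
  show ?thesis
    unfolding M exc bounds using imp if' small by blast
qed

end
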